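(* Let $\equiv$ be either $\equiv_{s,a}$ or $\equiv_{s,s}$. Let $T_1=\langle P_1,Q_1\rangle$ and $T_2=\langle P_2,Q_2\rangle$ be pairs of programs with $T_1\approx T_2$. (I) If $IC(T_1)=IC(T_2)$, then $P_1\equiv Q_1$ iff $P_2\equiv Q_2$. (II) If $IC(T_1)<IC(T_2)$, then $P_1\not\equiv Q_1$ implies $P_2\not\equiv Q_2$, and $P_2\equiv Q_2$ implies $P_1\equiv Q_1$.
   Context: Atoms are propositional. A rule $r$ is an expression $h_1\vee\cdots\vee h_k\leftarrow b_1,\dots,b_m,\mathit{not}\,c_1,\dots,\mathit{not}\,c_n$; write $H(r)$, $B^+(r)$, $B^-(r)$ for the sets of head, positive body and negative body atoms. A program is a finite set of rules. An interpretation $X$ satisfies $r$ iff $X\cap H(r)\neq\emptyset$ or $B^+(r)\not\subseteq X$ or $B^-(r)\cap X\neq\emptyset$. GL-reduct $P^X=\{H(r)\leftarrow B^+(r) : r\in P,\ B^-(r)\cap X=\emptyset\}$; $X$ is an ASP stable model of $P$ iff $X\models P^X$ and no proper subset of $X$ satisfies $P^X$; $X$ is an LP$^{\mathrm{MLN}}$ stable model of $P$ (weights omitted) iff $X$ is an ASP stable model of $\{r\in P: X\models r\}$. $P\equiv_{s,a}Q$ (resp. $P\equiv_{s,s}Q$) iff for every program $R$, $P\cup R$ and $Q\cup R$ have the same ASP (resp. LP$^{\mathrm{MLN}}$) stable models. Programs are regarded as tuples of rules (repetitions allowed); $\langle P,Q\rangle$ is the concatenation. For a tuple $T=\langle r_1,\dots,r_n\rangle$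 let $\langle S_1,\dots,S_{3n}\rangle=\langle H(r_1),B^+(r_1),B^-(r_1),\dots,H(r_n),B^+(r_n),B^-(r_n)\rangle$; for nonempty $N'\subseteq\{1,\dots,3n\}$ the independent set $I_{N'}=\bigcap_{i\in N'}S_i\setminus\bigcup_{j\notin N'}S_j$ is named $I_k$ with $k=\sum_{i\in N'}2^{3n-i}$ ($1\le k<2^{3n}$). Let $nis(T)$, $eis(T)$, $sis(T)$ be the sets of names $k$ with $I_k\neq\emptyset$, $I_k=\emptyset$, $|I_k|=1$ respectively. The IS-condition $IC(T)$ is the formula $\bigwedge_{i\in nis(T)}(I_i\neq\emptyset)\wedge\bigwedge_{j\in eis(T)}(I_j=\emptyset)\wedge\bigwedge_{k\in sis(T)}(|I_k|=1)$. For pairs, $\langle P_1,Q_1\rangle\approx\langle P_2,Q_2\rangle$ iff $|P_1|=|P_2|$ and $|Q_1|=|Q_2|$. For $T_1\approx T_2$: $IC(T_1)=IC(T_2)$ iff $nis(T_1)=nis(T_2)$ and $sis(T_1)=sis(T_2)$; $IC(T_1)<IC(T_2)$ iff $nis(T_1)=nis(T_2)$ and $sis(T_2)\subsetneq sis(T_1)$. *)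

theory Defs
  imports Main
begin

datatype 'a rule = Rule (head: "'a list") (pos_body: "'a list") (neg_body: "'a list")

definition H :: "'a rule \<Rightarrow> 'a set" where
  "H r = set (head r)"

definition Bpos :: "'a rule \<Rightarrow> 'a set" where
  "Bpos r = set (pos_body r)"

definition Bneg :: "'a rule \<Rightarrow> 'a set" where
  "Bneg r = set (neg_body r)"

definition sat_rule :: "'a set \<Rightarrow> 'a rule \<Rightarrow> bool" where
  "sat_rule X r \<longleftrightarrow> X \<inter> H r \<noteq> {} \<or> \<not> Bpos r \<subseteq> X \<or> Bneg r \<inter> X \<noteq> {}"

definition sat_program :: "'a set \<Rightarrow> 'a rule set \<Rightarrow> bool" where
  "sat_program X P \<longleftrightarrow> (\<forall>r\<in>P. sat_rule X r)"

definition GL_reduct :: "'a rule set \<Rightarrow> 'a set \<Rightarrow> 'a rule set" where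
  "GL_reduct P X = {Rule (head r) (pos_body r) [] | r. r \<in> P \<and> Bneg r \<inter> X = {}}"

definition asp_stable_model :: "'a rule set \<Rightarrow> 'a set \<Rightarrow> bool" where
  "asp_stable_model P X \<longleftrightarrow>
     sat_program X (GL_reduct P X) \<and> \<not> (\<exists>Y. Y \<subset> X \<and> sat_program Y (GL_reduct P X))"

definition lpmln_stable_model :: "'a rule set \<Rightarrow> 'a set \<Rightarrow> bool" where
  "lpmln_stable_model P X \<longleftrightarrow> asp_stable_model {r \<in> P. sat_rule X r} X"

text \<open>The two programs compared are tuples (lists) of rules. They enter the semantics only
  through their underlying finite sets of rules.\<close>

definition strong_equiv_asp :: "'a rule list \<Rightarrow> 'a rule list \<Rightarrow> bool" where
  "strong_equiv_asp P Q \<longleftrightarrow>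
     (\<forall>R. finite R \<longrightarrow>
        {X. asp_stable_model (set P \<union> R) X} = {X. asp_stable_model (set Q \<union> R) X})"

definition strong_equiv_lpmln :: "'a rule list \<Rightarrow> 'a rule list \<Rightarrow> bool" where
  "strong_equiv_lpmln P Q \<longleftrightarrow>
     (\<forall>R. finite R \<longrightarrow>
        {X. lpmln_stable_model (set P \<union> R) X} = {X. lpmln_stable_model (set Q \<union> R) X})"

definition component_sets :: "'a rule list \<Rightarrow> 'a set list" where
  "component_sets T = concat (map (\<lambda>r. [H r, Bpos r, Bneg r]) T)"

text \<open>Positions in the tuple of component sets are counted from 1.\<close>

definition component :: "'a rule list \<Rightarrow> nat \<Rightarrow> 'a set" where
  "component T i = component_sets T ! (i - 1)"

definition ind_set :: "'a rule list \<Rightarrow> nat set \<Rightarrow> 'a set" where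
  "ind_set T N = (\<Inter>i\<in>N. component T i) - (\<Union>j\<in>{1..3 * length T} - N. component T j)"

definition ind_set_name :: "'a rule list \<Rightarrow> nat set \<Rightarrow> nat" where
  "ind_set_name T N = (\<Sum>i\<in>N. 2 ^ (3 * length T - i))"

definition nis :: "'a rule list \<Rightarrow> nat set" where
  "nis T = {ind_set_name T N | N. N \<noteq> {} \<and> N \<subseteq> {1..3 * length T} \<and> ind_set T N \<noteq> {}}"

definition eis :: "'a rule list \<Rightarrow> nat set" where
  "eis T = {ind_set_name T N | N. N \<noteq> {} \<and> N \<subseteq> {1..3 * length T} \<and> ind_set T N = {}}"

definition sis :: "'a rule list \<Rightarrow> nat set" where
  "sis T = {ind_set_name T N | N. N \<noteq> {} \<and> N \<subseteq> {1..3 * length T} \<and> card (ind_set T N) = 1}"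

type_synonym 'a program_pair = "'a rule list \<times> 'a rule list"

definition pair_tuple :: "'a program_pair \<Rightarrow> 'a rule list" where
  "pair_tuple T = fst T @ snd T"

definition similar :: "'a program_pair \<Rightarrow> 'a program_pair \<Rightarrow> bool" (infix \<open>\<approx>\<close> 50) where
  "T1 \<approx> T2 \<longleftrightarrow> length (fst T1) = length (fst T2) \<and> length (snd T1) = length (snd T2)"

text \<open>An IS-condition is the formula determined by \<open>nis\<close>, \<open>eis\<close> and \<open>sis\<close>. The relations
  between IS-conditions are meant for similar pairs, for which \<open>eis\<close> is determined
  by \<open>nis\<close>.\<close>

definition IC_eq :: "'a program_pair \<Rightarrow> 'a program_pair \<Rightarrow> bool" where
  "IC_eq T1 T2 \<longleftrightarrow>
     nis (pair_tuple T1) = nis (pair_tuple T2) \<and> sis (pair_tuple T1) = sis (pair_tuple T2)"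

definition IC_less :: "'a program_pair \<Rightarrow> 'a program_pair \<Rightarrow> bool" where
  "IC_less T1 T2 \<longleftrightarrow>
     nis (pair_tuple T1) = nis (pair_tuple T2) \<and> sis (pair_tuple T2) \<subset> sis (pair_tuple T1)"

end

theory Submission
  imports Defs "HOL-Library.Nat_Bijection"
begin

text \<open>
  Both notions of strong equivalence are characterised by SE-models, that is, by pairs
  \<open>Y \<subseteq> X\<close> of finite interpretations. Whether \<open>(X, Y)\<close> satisfies a rule depends, for each
  independent set \<open>I\<close>, only on whether \<open>I\<close> meets \<open>X\<close>, \<open>- X\<close>, \<open>Y\<close> and \<open>- Y\<close>. These four
  answers can always be realised in another nonempty independent set, provided that it has at
  least two elements whenever \<open>I\<close> has: if \<open>I\<close> meets all of \<open>Y\<close>, \<open>X - Y\<close> and \<open>- X\<close>, then one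
  element in \<open>Y\<close> and one outside \<open>X\<close> already give the same answers. Hence an SE-model
  separating \<open>P\<^sub>1\<close> from \<open>Q\<^sub>1\<close> yields one separating \<open>P\<^sub>2\<close> from \<open>Q\<^sub>2\<close>.
\<close>

section \<open>SE-models\<close>

text \<open>Satisfaction by \<open>Y\<close> of what the reduct with respect to \<open>X\<close>
  leaves of \<open>r\<close>; a rule deleted by the reduct counts as satisfied.\<close>

definition sat_reduct :: "'a set \<Rightarrow> 'a set \<Rightarrow> 'a rule \<Rightarrow> bool" where
  "sat_reduct X Y r \<longleftrightarrow> Y \<inter> H r \<noteq> {} \<or> \<not> Bpos r \<subseteq> Y \<or> Bneg r \<inter> X \<noteq> {}"

text \<open>The flag selects between the ASP (hard) and the LP\<open>\<^sup>M\<^sup>L\<^sup>N\<close> (soft) reading.\<close>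

definition se_model :: "bool \<Rightarrow> 'a rule set \<Rightarrow> 'a set \<Rightarrow> 'a set \<Rightarrow> bool" where
  "se_model hard P X Y \<longleftrightarrow>
     (\<forall>r\<in>P. if hard then sat_rule X r \<and> sat_reduct X Y r
             else sat_rule X r \<longrightarrow> sat_reduct X Y r)"

definition stable :: "bool \<Rightarrow> 'a rule set \<Rightarrow> 'a set \<Rightarrow> bool" where
  "stable hard P X \<longleftrightarrow> se_model hard P X X \<and> \<not> (\<exists>Y. Y \<subset> X \<and> se_model hard P X Y)"

lemma sat_rule_eq_sat_reduct: "sat_rule X r = sat_reduct X X r"
  by (simp add: sat_rule_def sat_reduct_def)

lemma sat_program_GL_reduct: "sat_program Y (GL_reduct P X) \<longleftrightarrow> (\<forall>r\<in>P. sat_reduct X Y r)"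
  unfolding sat_program_def GL_reduct_def sat_reduct_def sat_rule_def H_def Bpos_def Bneg_def
  by fastforce

text \<open>The hard reading also demands \<open>sat_rule X r\<close>. This is the condition that
  \<open>X\<close> satisfies its own reduct, so it may be added for every \<open>Y\<close>.\<close>

lemma asp_stable_model_eq_stable: "asp_stable_model P X = stable True P X"
  by (simp add: asp_stable_model_def sat_program_GL_reduct stable_def se_model_def
      sat_rule_eq_sat_reduct ball_conj_distrib cong: conj_cong)

text \<open>Dropping the rules violated by \<open>X\<close> becomes the premise
  \<open>sat_rule X r\<close> of the soft condition.\<close>

lemma lpmln_stable_model_eq_stable: "lpmln_stable_model P X = stable False P X"
  by (simp add: lpmln_stable_model_def asp_stable_model_def sat_program_GL_reduct stable_def
      se_model_def sat_rule_eq_sat_reduct Bex_def)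

lemma se_model_Un: "se_model h (P \<union> R) X Y \<longleftrightarrow> se_model h P X Y \<and> se_model h R X Y"
  by (auto simp: se_model_def)

lemma se_model_total: "se_model h P X Y \<Longrightarrow> se_model h P X X"
  by (auto simp: se_model_def sat_rule_eq_sat_reduct split: if_splits)

text \<open>Removing from \<open>X\<close> the atoms that occur in no head keeps the reduct
  satisfied: the heads meet \<open>X\<close> as before, and positive bodies only become harder to
  satisfy. By minimality nothing is removed.\<close>

lemma stable_subset_heads:
  assumes "stable h P X"
  shows "X \<subseteq> (\<Union>r\<in>P. H r)"
proof -
  define Y where "Y = X \<inter> (\<Union>r\<in>P. H r)"
  have "sat_reduct X Y r" if "r \<in> P" "sat_rule X r" for r
    using that by (auto simp: Y_def sat_reduct_def sat_rule_def)
  moreover have "se_model h P X X"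
    using assms by (simp add: stable_def)
  ultimately have "se_model h P X Y"
    by (auto simp: se_model_def split: if_splits)
  then have "Y = X"
    using assms by (auto simp: stable_def Y_def)
  then show ?thesis
    by (auto simp: Y_def)
qed

lemma stable_finite: "stable h P X \<Longrightarrow> finite P \<Longrightarrow> finite X"
  by (erule stable_subset_heads[THEN finite_subset]) (simp add: H_def)

text \<open>A context isolating the pair \<open>(X, Y)\<close>: the facts force \<open>Y\<close>,
  and the cyclic rules make the atoms of \<open>X - Y\<close> all true or all false, so only
  \<open>Y\<close> and \<open>X\<close> survive among the subsets of \<open>X\<close>.\<close>

definition frame :: "'a set \<Rightarrow> 'a set \<Rightarrow> 'a rule set" where
  "frame X Y = (\<lambda>a. Rule [a] [] []) ` Y
     \<union> (\<lambda>(a, b). Rule [a] [b] []) ` ((X - Y) \<times> (X - Y))"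

lemma se_model_frame:
  assumes "Y \<subseteq> X" "Z \<subseteq> X"
  shows "se_model h (frame X Y) X Z \<longleftrightarrow> Z = Y \<or> Z = X"
proof -
  have "sat_rule X r" if "r \<in> frame X Y" for r
    using that assms by (auto simp: frame_def sat_rule_def H_def)
  then have "se_model h (frame X Y) X Z \<longleftrightarrow> (\<forall>r\<in>frame X Y. sat_reduct X Z r)"
    by (auto simp: se_model_def)
  also have "\<dots> \<longleftrightarrow> Y \<subseteq> Z \<and> (\<forall>a\<in>X - Y. \<forall>b\<in>X - Y. b \<in> Z \<longrightarrow> a \<in> Z)"
    by (auto simp: frame_def sat_reduct_def H_def Bpos_def Bneg_def ball_Un)
  also have "\<dots> \<longleftrightarrow> Z = Y \<or> Z = X"
    using assms by blast
  finally show ?thesis .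
qed

lemma stable_Un_frame:
  assumes "Y \<subseteq> X"
  shows "stable h (P \<union> frame X Y) X \<longleftrightarrow> se_model h P X X \<and> (Y = X \<or> \<not> se_model h P X Y)"
  using assms by (auto simp: stable_def se_model_Un se_model_frame psubset_eq)

lemma strong_equiv_iff_se_model:
  assumes "finite P" "finite Q"
  shows "(\<forall>R. finite R \<longrightarrow> {X. stable h (P \<union> R) X} = {X. stable h (Q \<union> R) X}) \<longleftrightarrow>
    (\<forall>X Y. finite X \<longrightarrow> Y \<subseteq> X \<longrightarrow> se_model h P X Y = se_model h Q X Y)"
    (is "?L \<longleftrightarrow> ?R")
proof
  assume L: ?L
  show ?R
  proof (intro allI impI)
    fix X Y :: "'a set"
    assume X: "finite X" "Y \<subseteq> X"
    have eq: "stable h (P \<union> frame X Z) X = stable h (Q \<union> frame X Z) X" if "Z \<subseteq> X" for Z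
    proof -
      have "finite (frame X Z)"
        using X(1) that by (auto simp: frame_def intro: finite_subset)
      then show ?thesis
        using L by blast
    qed
    \<comment> \<open>\<open>frame X X\<close> adds only facts and compares the total pairs; with
      these settled, \<open>frame X Y\<close> compares \<open>(X, Y)\<close> itself.\<close>
    have "se_model h P X X = se_model h Q X X"
      using eq[of X] by (simp add: stable_Un_frame)
    then show "se_model h P X Y = se_model h Q X Y"
      using eq[OF X(2)] X(2) se_model_total[of h P X Y] se_model_total[of h Q X Y]
      by (auto simp: stable_Un_frame)
  qed
next
  assume R: ?R
  have "stable h (P \<union> R) X = stable h (Q \<union> R) X" if "finite R" for R X
  proof (cases "finite X")
    case True
    then show ?thesis
      using R by (auto simp: stable_def se_model_Un)
  next
    \<comment> \<open>SE-models are compared for finite \<open>X\<close> only, but an infinite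
      \<open>X\<close> is stable for neither of the two finite programs.\<close>
    case False
    then show ?thesis
      using stable_finite[of h _ X] assms that by blast
  qed
  then show ?L
    by blast
qed

definition se_equiv :: "bool \<Rightarrow> 'a rule list \<Rightarrow> 'a rule list \<Rightarrow> bool" where
  "se_equiv h P Q \<longleftrightarrow>
     (\<forall>X Y. finite X \<longrightarrow> Y \<subseteq> X \<longrightarrow> se_model h (set P) X Y = se_model h (set Q) X Y)"

lemma strong_equiv_asp_eq: "strong_equiv_asp P Q = se_equiv True P Q"
  by (simp add: strong_equiv_asp_def asp_stable_model_eq_stable strong_equiv_iff_se_model
      se_equiv_def)

lemma strong_equiv_lpmln_eq: "strong_equiv_lpmln P Q = se_equiv False P Q"
  by (simp add: strong_equiv_lpmln_def lpmln_stable_model_eq_stable strong_equiv_iff_se_model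
      se_equiv_def)

section \<open>Independent sets\<close>

lemma length_component_sets: "length (component_sets T) = 3 * length T"
  by (induction T) (auto simp: component_sets_def)

lemma component_sets_nth:
  assumes "j < length T" "k < 3"
  shows "component_sets T ! (3 * j + k) = [H (T ! j), Bpos (T ! j), Bneg (T ! j)] ! k"
  using assms(1)
proof (induction T arbitrary: j)
  case (Cons r T)
  have "component_sets (r # T) = [H r, Bpos r, Bneg r] @ component_sets T"
    by (simp add: component_sets_def)
  then show ?case
    using Cons assms(2) by (cases j) (auto simp: less_Suc_eq numeral_3_eq_3)
qed simp

text \<open>Rules are numbered from 0 but positions from 1, hence the offsets 1, 2, 3.\<close>

lemma component_index:
  assumes "j < length T"
  shows "component T (3 * j + 1) = H (T ! j)"
    "component T (3 * j + 2) = Bpos (T ! j)"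
    "component T (3 * j + 3) = Bneg (T ! j)"
  using component_sets_nth[OF assms, of 0] component_sets_nth[OF assms, of 1]
    component_sets_nth[OF assms, of 2] by (simp_all add: component_def)

lemma finite_component:
  assumes "i \<in> {1..3 * length T}"
  shows "finite (component T i)"
proof -
  have "component T i \<in> set (component_sets T)"
    using assms by (auto simp: component_def length_component_sets intro!: nth_mem)
  then show ?thesis
    by (auto simp: component_sets_def H_def Bpos_def Bneg_def)
qed

text \<open>The independent sets are the fibres of this map over nonempty index sets, which makes
  them disjoint; atoms with empty signature lie in no component.\<close>

definition signature :: "'a rule list \<Rightarrow> 'a \<Rightarrow> nat set" where
  "signature T a = {i \<in> {1..3 * length T}. a \<in> component T i}"

lemma ind_set_eq_signature:
  assumes "N \<subseteq> {1..3 * length T}"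
  shows "ind_set T N = {a. signature T a = N}"
  using assms unfolding ind_set_def signature_def by blast

lemma finite_ind_set:
  assumes "N \<noteq> {}" "N \<subseteq> {1..3 * length T}"
  shows "finite (ind_set T N)"
proof -
  obtain i where "i \<in> N"
    using assms by blast
  then have "ind_set T N \<subseteq> component T i" "finite (component T i)"
    using assms finite_component[of i T] by (auto simp: ind_set_def)
  then show ?thesis
    by (rule finite_subset)
qed

text \<open>A name is the binary code of the reflected index set, and \<open>set_encode\<close> is
  injective on finite sets.\<close>

lemma inj_on_ind_set_name: "inj_on (ind_set_name T) (Pow {1..3 * length T})"
proof (rule inj_onI)
  fix M N
  assume MN: "M \<in> Pow {1..3 * length T}" "N \<in> Pow {1..3 * length T}"
    and eq: "ind_set_name T M = ind_set_name T N"
  let ?f = "\<lambda>i. 3 * length T - i"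
  have inj: "inj_on ?f {1..3 * length T}"
    unfolding inj_on_def by (metis atLeastAtMost_iff diff_diff_cancel)
  have name: "ind_set_name T K = set_encode (?f ` K)" if "K \<in> Pow {1..3 * length T}" for K
    using inj_on_subset[OF inj, of K] that
    by (simp add: ind_set_name_def set_encode_def sum.reindex)
  have "finite (?f ` M)" "finite (?f ` N)"
    using MN by (auto intro: finite_subset)
  then have "?f ` M = ?f ` N"
    using eq MN by (simp add: name set_encode_eq)
  then show "M = N"
    using inj MN by (simp add: inj_on_image_eq_iff)
qed

lemma ind_set_name_cong: "length T = length T' \<Longrightarrow> ind_set_name T = ind_set_name T'"
  by (simp add: ind_set_name_def fun_eq_iff)

text \<open>The arbitrary property \<Phi> lets one argument by injectivity of names serve both
  \<open>nis\<close> and \<open>sis\<close>.\<close>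

lemma ind_set_name_mem_iff:
  assumes "N \<noteq> {}" "N \<subseteq> {1..3 * length T}"
  shows "ind_set_name T N \<in> {ind_set_name T M | M. M \<noteq> {} \<and> M \<subseteq> {1..3 * length T} \<and> \<Phi> M} \<longleftrightarrow> \<Phi> N"
  using assms inj_onD[OF inj_on_ind_set_name, of T N] by blast

lemma ind_set_name_nis:
  "N \<noteq> {} \<Longrightarrow> N \<subseteq> {1..3 * length T} \<Longrightarrow> ind_set_name T N \<in> nis T \<longleftrightarrow> ind_set T N \<noteq> {}"
  unfolding nis_def by (rule ind_set_name_mem_iff)

lemma ind_set_name_sis:
  "N \<noteq> {} \<Longrightarrow> N \<subseteq> {1..3 * length T} \<Longrightarrow> ind_set_name T N \<in> sis T \<longleftrightarrow> card (ind_set T N) = 1"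
  unfolding sis_def by (rule ind_set_name_mem_iff)

section \<open>Transfer of SE-models\<close>

text \<open>These are the questions a rule asks of an interpretation: heads and negative bodies are
  tested for meeting it, positive bodies for inclusion.\<close>

definition same_trace :: "'a set \<Rightarrow> 'a set \<Rightarrow> 'b set \<Rightarrow> 'b set \<Rightarrow> bool" where
  "same_trace B X B' X' \<longleftrightarrow> (B \<inter> X = {} \<longleftrightarrow> B' \<inter> X' = {}) \<and> (B \<subseteq> X \<longleftrightarrow> B' \<subseteq> X')"

text \<open>If \<open>B'\<close> has two elements, the chain \<open>{}\<close>, \<open>{u}\<close>,
  \<open>B'\<close> realises the three traces disjoint, partial and full, and
  \<open>Y \<subseteq> X\<close> keeps the choices for \<open>Y\<close> and \<open>X\<close> in
  order. If \<open>B'\<close> is a singleton, so is \<open>B\<close>, and membership is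
  copied.\<close>

lemma same_trace_exists:
  assumes "B = {} \<longleftrightarrow> B' = {}" "card B' = 1 \<longrightarrow> card B = 1" "Y \<subseteq> X"
  shows "\<exists>X' Y'. Y' \<subseteq> X' \<and> X' \<subseteq> B' \<and> same_trace B X B' X' \<and> same_trace B Y B' Y'"
proof -
  \<comment> \<open>Instantiations of \<open>wit\<close> list \<open>Y'\<close> before
    \<open>X'\<close>, by order of occurrence.\<close>
  have wit: ?thesis if "Y' \<subseteq> X' \<and> X' \<subseteq> B' \<and> same_trace B X B' X' \<and> same_trace B Y B' Y'" for X' Y'
    using that by blast
  show ?thesis
  proof (cases "B' = {}")
    case True
    then show ?thesis
      using assms by (auto simp: same_trace_def)
  next
    case nonempty: False
    then obtain u where u: "u \<in> B'"
      by blast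
    show ?thesis
    proof (cases "\<exists>v\<in>B'. v \<noteq> u")
      case True
      then obtain v where v: "v \<in> B'" "v \<noteq> u"
        by blast
      have B: "B \<noteq> {}"
        using assms(1) nonempty by blast
      consider "B \<inter> X = {}" | "B \<subseteq> Y"
        | "B \<subseteq> X" "B \<inter> Y = {}" | "B \<subseteq> X" "\<not> B \<subseteq> Y" "B \<inter> Y \<noteq> {}"
        | "\<not> B \<subseteq> X" "B \<inter> X \<noteq> {}" "B \<inter> Y = {}" | "\<not> B \<subseteq> X" "B \<inter> Y \<noteq> {}"
        by argo
      then show ?thesis
      proof cases
        case 1
        show ?thesis
          by (rule wit[of "{}" "{}"]) (use 1 B u assms(3) in \<open>auto simp: same_trace_def\<close>)
      next
        case 2
        show ?thesis
          by (rule wit[of B' B']) (use 2 B u assms(3) in \<open>auto simp: same_trace_def\<close>)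
      next
        case 3
        show ?thesis
          by (rule wit[of "{}" B']) (use 3 B u in \<open>auto simp: same_trace_def\<close>)
      next
        case 4
        show ?thesis
          by (rule wit[of "{u}" B']) (use 4 B u v in \<open>auto simp: same_trace_def\<close>)
      next
        case 5
        show ?thesis
          by (rule wit[of "{}" "{u}"]) (use 5 B u v in \<open>auto simp: same_trace_def\<close>)
      next
        case 6
        show ?thesis
          by (rule wit[of "{u}" "{u}"]) (use 6 B u v assms(3) in \<open>auto simp: same_trace_def\<close>)
      qed
    next
      case False
      then have B': "B' = {u}"
        using u by blast
      then obtain b where B: "B = {b}"
        using assms(2) by (auto simp: card_1_singleton_iff)
      show ?thesis
        by (rule wit[of "if b \<in> Y then {u} else {}" "if b \<in> X then {u} else {}"])
          (use B B' assms(3) in \<open>auto simp: same_trace_def\<close>)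
    qed
  qed
qed

lemma same_trace_cong:
  assumes "same_trace B X B' X'" "B' \<inter> X' = B' \<inter> X''"
  shows "same_trace B X B' X''"
proof -
  have "B' \<subseteq> X' \<longleftrightarrow> B' \<subseteq> X''"
    using assms(2) by blast
  then show ?thesis
    using assms by (simp add: same_trace_def)
qed

text \<open>Both tests on a union are conjunctions of the tests on its pieces.\<close>

lemma same_trace_UN:
  fixes B :: "'i \<Rightarrow> 'a set" and B' :: "'i \<Rightarrow> 'b set"
  assumes "\<And>i. i \<in> I \<Longrightarrow> same_trace (B i) X (B' i) X'"
  shows "same_trace (\<Union>i\<in>I. B i) X (\<Union>i\<in>I. B' i) X'"
proof -
  have UN_disjoint: "(\<Union>i\<in>I. C i) \<inter> Z = {} \<longleftrightarrow> (\<forall>i\<in>I. C i \<inter> Z = {})" for C :: "_ \<Rightarrow> 'c set" and Z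
    by blast
  show ?thesis
    using assms by (simp add: same_trace_def UN_subset_iff UN_disjoint)
qed

lemma same_trace_component:
  assumes len: "length T = length T'" and i: "i \<in> {1..3 * length T}"
    and tr: "\<And>N. N \<noteq> {} \<Longrightarrow> N \<subseteq> {1..3 * length T} \<Longrightarrow> same_trace (ind_set T N) X (ind_set T' N) X'"
  shows "same_trace (component T i) X (component T' i) X'"
proof -
  let ?\<N> = "{N. i \<in> N \<and> N \<subseteq> {1..3 * length T}}"
  \<comment> \<open>The separate type variable allows use for both \<open>T\<close> and
    \<open>T'\<close>, whose atoms may have different types.\<close>
  have union: "component S i = (\<Union>N\<in>?\<N>. ind_set S N)" if "length S = length T" for S :: "'c rule list"
  proof (rule set_eqI)
    fix a
    have "a \<in> (\<Union>N\<in>?\<N>. ind_set S N) \<longleftrightarrow> signature S a \<in> ?\<N>"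
      using that by (auto simp: ind_set_eq_signature)
    also have "\<dots> \<longleftrightarrow> a \<in> component S i"
      using i that by (auto simp: signature_def)
    finally show "a \<in> component S i \<longleftrightarrow> a \<in> (\<Union>N\<in>?\<N>. ind_set S N)" ..
  qed
  have "same_trace (ind_set T N) X (ind_set T' N) X'" if "N \<in> ?\<N>" for N
    using that tr[of N] by blast
  then show ?thesis
    unfolding union[OF refl] union[OF len[symmetric]] by (rule same_trace_UN)
qed

lemma sat_reduct_cong:
  assumes "same_trace (H r) Y (H r') Y'" "same_trace (Bpos r) Y (Bpos r') Y'"
    "same_trace (Bneg r) X (Bneg r') X'"
  shows "sat_reduct X Y r = sat_reduct X' Y' r'"
  using assms by (simp add: sat_reduct_def same_trace_def Int_commute)

lemma se_model_transfer:
  assumes len: "length T = length T'" and nis: "nis T = nis T'" and sis: "sis T' \<subseteq> sis T"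
    and YX: "Y \<subseteq> X"
  obtains X' Y' where "finite X'" "Y' \<subseteq> X'"
    "\<And>j. j < length T \<Longrightarrow> sat_rule X (T ! j) = sat_rule X' (T' ! j)"
    "\<And>j. j < length T \<Longrightarrow> sat_reduct X Y (T ! j) = sat_reduct X' Y' (T' ! j)"
proof -
  let ?\<N> = "{N. N \<noteq> {} \<and> N \<subseteq> {1..3 * length T}}"
  have "\<forall>N\<in>?\<N>. \<exists>X' Y'. Y' \<subseteq> X' \<and> X' \<subseteq> ind_set T' N \<and>
      same_trace (ind_set T N) X (ind_set T' N) X' \<and> same_trace (ind_set T N) Y (ind_set T' N) Y'"
  proof
    fix N assume "N \<in> ?\<N>"
    then have N: "N \<noteq> {}" "N \<subseteq> {1..3 * length T}" "N \<subseteq> {1..3 * length T'}"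
      using len by auto
    show "\<exists>X' Y'. Y' \<subseteq> X' \<and> X' \<subseteq> ind_set T' N \<and>
      same_trace (ind_set T N) X (ind_set T' N) X' \<and> same_trace (ind_set T N) Y (ind_set T' N) Y'"
    proof (rule same_trace_exists)
      show "ind_set T N = {} \<longleftrightarrow> ind_set T' N = {}"
        using ind_set_name_nis[OF N(1,2)] ind_set_name_nis[OF N(1,3)] nis ind_set_name_cong[OF len]
        by auto
      show "card (ind_set T' N) = 1 \<longrightarrow> card (ind_set T N) = 1"
        using ind_set_name_sis[OF N(1,2)] ind_set_name_sis[OF N(1,3)] sis ind_set_name_cong[OF len]
        by auto
    qed (rule YX)
  qed
  from bchoice[OF this] obtain F where "\<forall>N\<in>?\<N>. \<exists>Y'. Y' \<subseteq> F N \<and> F N \<subseteq> ind_set T' N \<and>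
      same_trace (ind_set T N) X (ind_set T' N) (F N) \<and>
      same_trace (ind_set T N) Y (ind_set T' N) Y'" ..
  from bchoice[OF this] obtain G where "\<forall>N\<in>?\<N>. G N \<subseteq> F N \<and> F N \<subseteq> ind_set T' N \<and>
      same_trace (ind_set T N) X (ind_set T' N) (F N) \<and>
      same_trace (ind_set T N) Y (ind_set T' N) (G N)" ..
  note FG = bspec[OF this]
  define X' Y' where "X' = (\<Union>N\<in>?\<N>. F N)" and "Y' = (\<Union>N\<in>?\<N>. G N)"
  have ind_set_unique: "M = N" if "M \<in> ?\<N>" "N \<in> ?\<N>" "a \<in> ind_set T' M" "a \<in> ind_set T' N" for M N a
    using that len by (simp add: ind_set_eq_signature)
  \<comment> \<open>Local choices do not interfere: each stays inside its own independent set, and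
    these are disjoint.\<close>
  have Int_UN: "ind_set T' N \<inter> (\<Union>M\<in>?\<N>. K M) = ind_set T' N \<inter> K N"
    if N: "N \<in> ?\<N>" and K: "\<And>M. M \<in> ?\<N> \<Longrightarrow> K M \<subseteq> ind_set T' M" for K N
  proof -
    have "M = N" if "M \<in> ?\<N>" "a \<in> K M" "a \<in> ind_set T' N" for M a
      using ind_set_unique[OF that(1) N] K[OF that(1)] that by blast
    then show ?thesis
      using N by blast
  qed
  have trX: "same_trace (ind_set T N) X (ind_set T' N) X'" if "N \<in> ?\<N>" for N
  proof (rule same_trace_cong)
    show "ind_set T' N \<inter> F N = ind_set T' N \<inter> X'"
      unfolding X'_def by (rule Int_UN[symmetric, OF that]) (use FG in blast)
  qed (use FG[OF that] in blast)
  have trY: "same_trace (ind_set T N) Y (ind_set T' N) Y'" if "N \<in> ?\<N>" for N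
  proof (rule same_trace_cong)
    show "ind_set T' N \<inter> G N = ind_set T' N \<inter> Y'"
      unfolding Y'_def by (rule Int_UN[symmetric, OF that]) (use FG in blast)
  qed (use FG[OF that] in blast)
  have comp: "same_trace (component T i) X (component T' i) X'"
    "same_trace (component T i) Y (component T' i) Y'" if "i \<in> {1..3 * length T}" for i
    by (rule same_trace_component[OF len that], rule trX, simp,
        rule same_trace_component[OF len that], rule trY, simp)
  have parts:
    "same_trace (H (T ! j)) X (H (T' ! j)) X'" "same_trace (H (T ! j)) Y (H (T' ! j)) Y'"
    "same_trace (Bpos (T ! j)) X (Bpos (T' ! j)) X'" "same_trace (Bpos (T ! j)) Y (Bpos (T' ! j)) Y'"
    "same_trace (Bneg (T ! j)) X (Bneg (T' ! j)) X'" if "j < length T" for j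
    using that len comp[of "3 * j + 1"] comp[of "3 * j + 2"] comp[of "3 * j + 3"]
      component_index[of j T] component_index[of j T'] by auto
  show ?thesis
  proof
    \<comment> \<open>\<open>X'\<close> contains no atoms outside all components, so it lies in
      finitely many finite independent sets.\<close>
    have "finite (F N)" if "N \<in> ?\<N>" for N
      using FG[OF that] that finite_ind_set[of N T'] len by (auto intro: finite_subset)
    then show "finite X'"
      unfolding X'_def by (auto intro: finite_subset[of _ "Pow {1..3 * length T}"])
    show "Y' \<subseteq> X'"
      using FG unfolding X'_def Y'_def by blast
    show "sat_rule X (T ! j) = sat_rule X' (T' ! j)" if "j < length T" for j
      unfolding sat_rule_eq_sat_reduct using parts[OF that] by (intro sat_reduct_cong)
    show "sat_reduct X Y (T ! j) = sat_reduct X' Y' (T' ! j)" if "j < length T" for j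
      using parts[OF that] by (intro sat_reduct_cong)
  qed
qed

text \<open>The inclusion of \<open>sis\<close> covers both parts of the theorem: equality of
  conditions yields it in both directions, \<open>IC_less\<close> in this one.\<close>

lemma se_equiv_transfer:
  assumes sim: "(P1, Q1) \<approx> (P2, Q2)"
    and nis: "nis (P1 @ Q1) = nis (P2 @ Q2)" and sis: "sis (P2 @ Q2) \<subseteq> sis (P1 @ Q1)"
    and equiv: "se_equiv h P2 Q2"
  shows "se_equiv h P1 Q1"
  unfolding se_equiv_def
proof (intro allI impI)
  fix X Y :: "'a set"
  assume "finite X" and YX: "Y \<subseteq> X"
  have len: "length P1 = length P2" "length Q1 = length Q2" "length (P1 @ Q1) = length (P2 @ Q2)"
    using sim by (auto simp: similar_def)
  obtain X' Y' where fin: "finite X'" "Y' \<subseteq> X'"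
    and rule: "\<And>j. j < length (P1 @ Q1) \<Longrightarrow>
      sat_rule X ((P1 @ Q1) ! j) = sat_rule X' ((P2 @ Q2) ! j)"
    and reduct: "\<And>j. j < length (P1 @ Q1) \<Longrightarrow>
      sat_reduct X Y ((P1 @ Q1) ! j) = sat_reduct X' Y' ((P2 @ Q2) ! j)"
    using se_model_transfer[OF len(3) nis sis YX] by blast
  have P: "sat_rule X (P1 ! j) = sat_rule X' (P2 ! j)"
    "sat_reduct X Y (P1 ! j) = sat_reduct X' Y' (P2 ! j)" if "j < length P2" for j
    using rule[of j] reduct[of j] that len by (auto simp: nth_append)
  have Q: "sat_rule X (Q1 ! j) = sat_rule X' (Q2 ! j)"
    "sat_reduct X Y (Q1 ! j) = sat_reduct X' Y' (Q2 ! j)" if "j < length Q2" for j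
    \<comment> \<open>As \<open>P1\<close> and \<open>P2\<close> have equal length, the same offset
      reaches \<open>Q1\<close> and \<open>Q2\<close>.\<close>
    using rule[of "length P1 + j"] reduct[of "length P1 + j"] that len by (auto simp: nth_append)
  have "se_model h (set P1) X Y = se_model h (set P2) X' Y'"
    using P len by (simp add: se_model_def all_set_conv_all_nth)
  also have "\<dots> = se_model h (set Q2) X' Y'"
    using equiv fin by (simp add: se_equiv_def)
  also have "\<dots> = se_model h (set Q1) X Y"
    using Q len by (simp add: se_model_def all_set_conv_all_nth)
  finally show "se_model h (set P1) X Y = se_model h (set Q1) X Y" .
qed

theorem theorem8:
  fixes P1 Q1 P2 Q2 :: "'a rule list"
    and eqv :: "'a rule list \<Rightarrow> 'a rule list \<Rightarrow> bool"
  assumes "eqv = strong_equiv_asp \<or> eqv = strong_equiv_lpmln"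
    and "(P1, Q1) \<approx> (P2, Q2)"
  shows "(IC_eq (P1, Q1) (P2, Q2) \<longrightarrow> (eqv P1 Q1 \<longleftrightarrow> eqv P2 Q2)) \<and>
    (IC_less (P1, Q1) (P2, Q2) \<longrightarrow>
      (\<not> eqv P1 Q1 \<longrightarrow> \<not> eqv P2 Q2) \<and> (eqv P2 Q2 \<longrightarrow> eqv P1 Q1))"
proof -
  obtain h where h: "eqv = se_equiv h"
    using assms(1) by (metis ext strong_equiv_asp_eq strong_equiv_lpmln_eq)
  have sim': "(P2, Q2) \<approx> (P1, Q1)"
    using assms(2) by (simp add: similar_def)
  show ?thesis
    using se_equiv_transfer[OF assms(2), of h] se_equiv_transfer[OF sim', of h]
    unfolding h IC_eq_def IC_less_def pair_tuple_def by auto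
qed

end
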